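(* Let $\bar T>0$ be given and assume that there exist a bounded continuously differentiable matrix-valued function $S:[0,\bar T]\times\mathcal{P}\to\mathbb{S}^n_{\succ0}$ and a scalar $\varepsilon>0$ such that $$\partial_\tau S(\tau,\theta)+\partial_\rho S(\tau,\theta)\mu+\mathrm{Sym}[S(\tau,\theta)A(\theta)]+\varepsilon I_n\preceq0$$ and $$S(0,\theta)-S(\bar T,\eta)\preceq0$$ hold for all $\theta,\eta\in\mathcal{P}$, all $\mu\in\mathcal{D}^v$ and all $\tau\in[0,\bar T]$. Then the LPV system $\dot x(t)=A(\rho(t))x(t)$, $x(0)=x_0$, with parameter trajectories $\rho\in\mathscr{P}_{\bar T}$ is asymptotically stable.
   Context: Notation: $\mathbb{S}^n$ is the set of real symmetric $n\times n$ matrices, $\mathbb{S}^n_{\succ0}$ the positive definite ones; $A\preceq B$ means that $B-A$ is positive semidefinite; $\mathrm{Sym}[M]:=M+M^T$; $I_n$ is the identity matrix; $\mathbb{N}_0$ is the set of nonnegative integers. Setting: $\mathcal{P}=\mathcal{P}_1\times\dots\times\mathcal{P}_N\subset\mathbb{R}^N$ with $\mathcal{P}_i=[\underline\rho_i,\bar\rho_i]$, $\underline\rho_i\le\bar\rho_i$; $\mathcal{D}=\mathcal{D}_1\times\dots\times\mathcal{D}_N$ with $\mathcal{D}_i=[\underline\nu_i,\bar\nu_i]$, $\underline\nu_i\le\bar\nu_i$; $\mathcal{D}^v=\{\underline\nu_1,\bar\nu_1\}\times\dots\times\{\underline\nu_N,\bar\nu_N\}$ is the set of vertices of $\mathcal{D}$.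 The function $A:\mathcal{P}\to\mathbb{R}^{n\times n}$ is bounded and continuous. For $S=S(\tau,\rho)$, $\partial_\tau S$ is the partial derivative with respect to the first argument and $\partial_\rho S(\tau,\theta)\mu:=\sum_{i=1}^N\mu_i\,\partial_{\rho_i}S(\tau,\theta)$. Derivatives at the boundary of $[0,\bar T]\times\mathcal{P}$ are one-sided, and $\partial_{\rho_i}S:=0$ if $\underline\rho_i=\bar\rho_i$. For $\rho\in\mathcal{P}$, $\mathcal{Q}(\rho)=\mathcal{Q}_1(\rho)\times\dots\times\mathcal{Q}_N(\rho)$, where $\mathcal{Q}_i(\rho)=\mathcal{D}_i$ if $\rho_i\in(\underline\rho_i,\bar\rho_i)$, $\mathcal{Q}_i(\rho)=\mathcal{D}_i\cap\mathbb{R}_{\ge0}$ if $\rho_i=\underline\rho_i$, and $\mathcal{Q}_i(\rho)=\mathcal{D}_i\cap\mathbb{R}_{\le0}$ if $\rho_i=\bar\rho_i$. $\mathscr{P}_{\bar T}$ is the set of piecewise differentiable, left-continuous functions $\rho:\mathbb{R}_{\ge0}\to\mathcal{P}$ such that, with $t_k=k\bar T$, $k\in\mathbb{N}_0$ (so that $t_{k+1}-t_k=\bar T$ and $t_0=0$), $\rho$ is differentiable with $\dot\rho(t)\in\mathcal{Q}(\rho(t))$ for all $t\in(t_k,t_{k+1})$ and all $k\in\mathbb{N}_0$. Jumps of $\rho$ to arbitrary values in $\mathcal{P}$ may occur only at the times $t_k$, $k\ge1$ (no discontinuity occurs at $t_0=0$). Solutions $x$ are continuous on $\mathbb{R}_{\ge0}$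 and satisfy $\dot x(t)=A(\rho(t))x(t)$ for all $t\notin\{t_k\}$. The LPV system with parameter trajectories in a family $\mathscr{P}$ is asymptotically stable if $x=0$ is globally asymptotically stable uniformly over the family: (i) there is a class-$\mathcal{K}_\infty$ function $\alpha$ with $|x(t)|\le\alpha(|x_0|)$ for all $t\ge0$, $x_0\in\mathbb{R}^n$, $\rho\in\mathscr{P}$; and (ii) for all $r,\epsilon>0$ there is $t^*\ge 0$ such that $|x_0|\le r$, $\rho\in\mathscr{P}$ and $t\ge t^*$ imply $|x(t)|\le\epsilon$. *)

theory Defs
  imports "HOL-Analysis.Analysis"
begin

definition pos_def :: "real^'n^'n \<Rightarrow> bool" where
  "pos_def M \<longleftrightarrow> transpose M = M \<and> (\<forall>v. v \<noteq> 0 \<longrightarrow> v \<bullet> (M *v v) > 0)"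

definition pos_semidef :: "real^'n^'n \<Rightarrow> bool" where
  "pos_semidef M \<longleftrightarrow> transpose M = M \<and> (\<forall>v. v \<bullet> (M *v v) \<ge> 0)"

definition loewner_le :: "real^'n^'n \<Rightarrow> real^'n^'n \<Rightarrow> bool"  (infix "\<preceq>\<^sub>L" 50) where
  "A \<preceq>\<^sub>L B \<longleftrightarrow> pos_semidef (B - A)"

definition Sym :: "real^'n^'n \<Rightarrow> real^'n^'n" where
  "Sym M = M + transpose M"

text \<open>
  The parameter box and the rate box are \<open>cbox lo hi\<close> and \<open>cbox nlo nhi\<close>, the products
  of the coordinate intervals.
\<close>

definition box_vertices :: "real^'p \<Rightarrow> real^'p \<Rightarrow> (real^'p) set" where
  "box_vertices a b = {\<mu>. \<forall>i. \<mu> $ i \<in> {a $ i, b $ i}}"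

text \<open>
  The following set is a product over the coordinates. In a degenerate coordinate
  (\<open>lo $ i = hi $ i\<close>) both sign conditions apply, so the only possible rate there is 0,
  which is the derivative of a constant parameter.
\<close>

definition admissible_rates ::
    "real^'p \<Rightarrow> real^'p \<Rightarrow> real^'p \<Rightarrow> real^'p \<Rightarrow> real^'p \<Rightarrow> (real^'p) set" where
  "admissible_rates lo hi nlo nhi \<theta> =
     {\<mu> \<in> cbox nlo nhi. \<forall>i. (\<theta> $ i = lo $ i \<longrightarrow> \<mu> $ i \<ge> 0) \<and> (\<theta> $ i = hi $ i \<longrightarrow> \<mu> $ i \<le> 0)}"

text \<open>
  Partial derivatives on \<open>{0..T} \<times> cbox lo hi\<close>. Taking the derivative within the coordinate
  interval makes it one-sided at the end points.
\<close>

definition partial_tau ::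
    "real \<Rightarrow> (real \<Rightarrow> real^'p \<Rightarrow> real^'n^'n) \<Rightarrow> real \<Rightarrow> real^'p \<Rightarrow> real^'n^'n" where
  "partial_tau T S \<tau> \<theta> = vector_derivative (\<lambda>s. S s \<theta>) (at \<tau> within {0..T})"

definition partial_param ::
    "real^'p \<Rightarrow> real^'p \<Rightarrow> (real \<Rightarrow> real^'p \<Rightarrow> real^'n^'n) \<Rightarrow> 'p \<Rightarrow> real \<Rightarrow> real^'p \<Rightarrow> real^'n^'n" where
  "partial_param lo hi S i \<tau> \<theta> =
     (if lo $ i = hi $ i then 0
      else vector_derivative (\<lambda>r. S \<tau> (\<chi> j. if j = i then r else \<theta> $ j))
             (at (\<theta> $ i) within {lo $ i..hi $ i}))"

definition param_derivative ::
    "real^'p \<Rightarrow> real^'p \<Rightarrow> (real \<Rightarrow> real^'p \<Rightarrow> real^'n^'n) \<Rightarrow> real \<Rightarrow> real^'p \<Rightarrow> real^'p \<Rightarrow> real^'n^'n" where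
  "param_derivative lo hi S \<tau> \<theta> \<mu> = (\<Sum>i\<in>UNIV. \<mu> $ i *\<^sub>R partial_param lo hi S i \<tau> \<theta>)"

text \<open>
  Continuity of the derivative is expressed through the partial derivatives: when some
  coordinate interval is degenerate, the Frechet derivative within the box is not unique.
\<close>

definition continuously_differentiable ::
    "real \<Rightarrow> real^'p \<Rightarrow> real^'p \<Rightarrow> (real \<Rightarrow> real^'p \<Rightarrow> real^'n^'n) \<Rightarrow> bool" where
  "continuously_differentiable T lo hi S \<longleftrightarrow>
     (\<lambda>(\<tau>, \<theta>). S \<tau> \<theta>) differentiable_on ({0..T} \<times> cbox lo hi) \<and>
     continuous_on ({0..T} \<times> cbox lo hi) (\<lambda>(\<tau>, \<theta>). partial_tau T S \<tau> \<theta>) \<and>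
     (\<forall>i. continuous_on ({0..T} \<times> cbox lo hi) (\<lambda>(\<tau>, \<theta>). partial_param lo hi S i \<tau> \<theta>))"

definition switching_times :: "real \<Rightarrow> real set" where
  "switching_times T = range (\<lambda>k. real k * T)"

text \<open>
  Trajectories are total functions on the reals; only their values at nonnegative times are
  constrained. Left continuity is required at \<open>t > 0\<close>, and right continuity at 0 because no
  jump is allowed there.
\<close>

definition param_trajectories ::
    "real \<Rightarrow> real^'p \<Rightarrow> real^'p \<Rightarrow> real^'p \<Rightarrow> real^'p \<Rightarrow> (real \<Rightarrow> real^'p) set" where
  "param_trajectories T lo hi nlo nhi =
     {\<rho>. (\<forall>t\<ge>0. \<rho> t \<in> cbox lo hi) \<and>
         (\<forall>t>0. continuous (at_left t) \<rho>) \<and>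
         continuous (at_right 0) \<rho> \<and>
         (\<forall>k::nat. \<forall>t\<in>{real k * T<..<real (Suc k) * T}.
            \<exists>d\<in>admissible_rates lo hi nlo nhi (\<rho> t). (\<rho> has_vector_derivative d) (at t))}"

definition lpv_solution ::
    "real set \<Rightarrow> (real^'p \<Rightarrow> real^'n^'n) \<Rightarrow> (real \<Rightarrow> real^'p) \<Rightarrow> real^'n \<Rightarrow> (real \<Rightarrow> real^'n) \<Rightarrow> bool" where
  "lpv_solution J A \<rho> x0 x \<longleftrightarrow>
     continuous_on {0..} x \<and> x 0 = x0 \<and>
     (\<forall>t. t \<ge> 0 \<and> t \<notin> J \<longrightarrow> (x has_vector_derivative (A (\<rho> t) *v x t)) (at t within {0..}))"

definition class_K_infinity :: "(real \<Rightarrow> real) \<Rightarrow> bool" where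
  "class_K_infinity \<alpha> \<longleftrightarrow>
     continuous_on {0..} \<alpha> \<and> strict_mono_on {0..} \<alpha> \<and> \<alpha> 0 = 0 \<and> filterlim \<alpha> at_top at_top"

text \<open>
  \<open>J\<close> is the set of times at which the differential equation is not required to hold, and
  \<open>F\<close> is the family of parameter trajectories.
\<close>

definition lpv_asymptotically_stable ::
    "real set \<Rightarrow> (real^'p \<Rightarrow> real^'n^'n) \<Rightarrow> (real \<Rightarrow> real^'p) set \<Rightarrow> bool" where
  "lpv_asymptotically_stable J A F \<longleftrightarrow>
     (\<exists>\<alpha>. class_K_infinity \<alpha> \<and>
        (\<forall>\<rho>\<in>F. \<forall>x0 x. lpv_solution J A \<rho> x0 x \<longrightarrow> (\<forall>t\<ge>0. norm (x t) \<le> \<alpha> (norm x0)))) \<and>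
     (\<forall>r>0. \<forall>\<epsilon>>0. \<exists>t'\<ge>0. \<forall>\<rho>\<in>F. \<forall>x0 x.
        norm x0 \<le> r \<longrightarrow> lpv_solution J A \<rho> x0 x \<longrightarrow> (\<forall>t\<ge>t'. norm (x t) \<le> \<epsilon>))"

end

theory Submission
  imports Defs
begin

text \<open>
  The quadratic form \<open>V = x \<bullet> S(\<tau>, \<rho>) x\<close>, where the clock \<open>\<tau>\<close> is the time elapsed since the last
  switching time, is a Lyapunov function for the whole family of trajectories.

  Between two switching times the chain rule gives \<open>V' = x \<bullet> (\<partial>\<^sub>\<tau>S + \<partial>\<^sub>\<rho>S \<rho>' + Sym (S A)) x\<close>. The
  first matrix inequality is assumed only at the vertices of the rate box, but its left-hand side is
  affine in the rate, so it holds on the whole box and \<open>V' \<le> - \<epsilon> |x|\<^sup>2\<close>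
  (\<open>derivative_along_trajectory\<close>, \<open>affine_le_if_vertices_le\<close>, \<open>dissipation\<close>). By compactness there
  are constants with \<open>c1 |x|\<^sup>2 \<le> V \<le> c2 |x|\<^sup>2\<close> (\<open>pos_def_uniform_bounds\<close>). Therefore
  \<open>V' \<le> - (\<epsilon> / c2) V\<close>, and \<open>V\<close> multiplied by \<open>exp ((\<epsilon> / c2) t)\<close> does not increase
  (\<open>weighted_energy_antimono\<close>).

  At a switching time \<open>a\<close> the state is continuous, the clock is reset from \<open>T\<close> to 0 and the parameter
  may jump. Since \<open>S(0, \<theta>) \<preceq> S(T, \<eta>)\<close> for all \<open>\<theta>\<close> and \<open>\<eta>\<close>, the value of \<open>V\<close> cannot
  increase there either. This is carried over to the times just after the jump: shortly after \<open>a\<close> the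
  form \<open>S(t - a, \<theta>)\<close> at \<open>x(t)\<close> is close to the form \<open>S(0, \<theta>)\<close> at \<open>x(a)\<close> uniformly in \<open>\<theta>\<close>, and the latter
  is bounded by \<open>S(T, \<eta>)\<close> at \<open>x(a)\<close> whatever \<open>\<theta>\<close> is (\<open>eventually_quad_le_after_switch\<close>,
  \<open>weighted_energy_le_at_switch\<close>). Chaining the intervals
  yields \<open>c1 |x(t)|\<^sup>2 \<le> exp (- (\<epsilon> / c2) t) c2 |x(0)|\<^sup>2\<close> with constants common to all
  trajectories (\<open>exponential_decay\<close>), which is uniform exponential stability.
\<close>

section \<open>Quadratic forms\<close>

abbreviation quad :: "real^'n^'n \<Rightarrow> real^'n \<Rightarrow> real" where
  "quad M v \<equiv> v \<bullet> (M *v v)"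

lemma bounded_bilinear_matrix_vector_mult:
  "bounded_bilinear ((*v) :: real^'n^'m \<Rightarrow> real^'n \<Rightarrow> real^'m)"
  unfolding bilinear_conv_bounded_bilinear[symmetric] bilinear_def
  by (auto intro!: linearI simp: algebra_simps matrix_vector_mult_scaleR scaleR_matrix_vector_assoc)

lemma quad_Sym: "quad (Sym M) v = 2 * quad M v"
  by (simp add: Sym_def matrix_vector_mult_add_rdistrib inner_add_right inner_commute[of v]
      dot_lmul_matrix)

lemma quad_sum: "quad (\<Sum>i\<in>I. M i) v = (\<Sum>i\<in>I. quad (M i) v)"
  by (induction I rule: infinite_finite_induct)
    (auto simp: matrix_vector_mult_add_rdistrib inner_add_right)

lemma quad_scaleR: "quad (c *\<^sub>R M) v = c * quad M v"
  by (simp flip: scaleR_matrix_vector_assoc)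

lemma quad_scaleR_vector: "quad M (c *\<^sub>R v) = c\<^sup>2 * quad M v"
  by (simp add: matrix_vector_mult_scaleR power2_eq_square)

lemma loewner_le_quad: "M \<preceq>\<^sub>L N \<Longrightarrow> quad M v \<le> quad N v"
  by (auto simp: loewner_le_def pos_semidef_def matrix_vector_mult_diff_rdistrib inner_diff_right)

text \<open>
  Symmetry of \<open>G\<close> merges the two terms in which the state is differentiated into \<open>Sym (G B)\<close>.
\<close>

lemma quad_has_real_derivative:
  assumes G: "(G has_vector_derivative G') (at t)"
    and x: "(x has_vector_derivative B *v x t) (at t)"
    and sym: "transpose (G t) = G t"
  shows "((\<lambda>t. quad (G t) (x t)) has_real_derivative quad (G' + Sym (G t ** B)) (x t)) (at t)"
proof -
  have "(B *v x t) \<bullet> (G t *v x t) = quad (G t ** B) (x t)"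
    by (metis sym dot_lmul_matrix inner_commute matrix_vector_mul_assoc transpose_matrix_vector)
  moreover have "((\<lambda>t. quad (G t) (x t)) has_vector_derivative
      (x t \<bullet> (G t *v (B *v x t) + G' *v x t) + (B *v x t) \<bullet> (G t *v x t))) (at t)"
    by (intro bounded_bilinear.has_vector_derivative[OF bounded_bilinear_inner]
        bounded_bilinear.has_vector_derivative[OF bounded_bilinear_matrix_vector_mult] G x)
  ultimately show ?thesis
    by (simp add: has_real_derivative_iff_has_vector_derivative quad_Sym inner_add_right
        matrix_vector_mult_add_rdistrib matrix_vector_mul_assoc algebra_simps)
qed

text \<open>
  An affine function on a box is largest at the vertex that takes, in each coordinate, the upper end
  point if the coefficient there is nonnegative and the lower one otherwise.
\<close>

lemma affine_le_if_vertices_le: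
  fixes b :: "'p::finite \<Rightarrow> real"
  assumes vertices: "\<And>\<mu>. \<mu> \<in> box_vertices l u \<Longrightarrow> a + (\<Sum>i\<in>UNIV. \<mu> $ i * b i) \<le> c"
    and d: "d \<in> cbox l u"
  shows "a + (\<Sum>i\<in>UNIV. d $ i * b i) \<le> c"
proof -
  define \<mu> :: "real^'p" where "\<mu> = (\<chi> i. if b i \<ge> 0 then u $ i else l $ i)"
  have "(\<Sum>i\<in>UNIV. d $ i * b i) \<le> (\<Sum>i\<in>UNIV. \<mu> $ i * b i)"
    using d by (intro sum_mono) (auto simp: \<mu>_def mem_box_cart mult_right_mono mult_right_mono_neg)
  moreover have "\<mu> \<in> box_vertices l u"
    by (auto simp: \<mu>_def box_vertices_def)
  ultimately show ?thesis using vertices[of \<mu>] by linarith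
qed

section \<open>The certificate along a trajectory\<close>

lemma has_derivative_compose_within:
  assumes "(f has_derivative f') (at x within s)" "(g has_derivative g') (at y within t)"
    and "f x = y" "f ` s \<subseteq> t"
  shows "((\<lambda>x. g (f x)) has_derivative (\<lambda>h. g' (f' h))) (at x within s)"
  using assms by (auto intro: has_derivative_in_compose has_derivative_subset)

text \<open>
  The derivative \<open>S'\<close> within the box need not be unique when the box has degenerate coordinates, but the
  values of any choice on the clock axis and on the nondegenerate axes are the partial derivatives.
  This lemma and the next say so, and it is all that the chain rule needs.
\<close>

lemma partial_tau_eq_frechet:
  assumes S': "((\<lambda>(\<tau>, \<theta>). S \<tau> \<theta>) has_derivative S') (at (\<tau>, \<theta>) within {0..T} \<times> cbox lo hi)"
    and "T > 0" "\<tau> \<in> {0..T}" "\<theta> \<in> cbox lo hi"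
  shows "partial_tau T S \<tau> \<theta> = S' (1, 0)"
proof -
  have "((\<lambda>s. (s, \<theta>)) has_derivative (\<lambda>h. (h, 0))) (at \<tau> within {0..T})"
    by (auto intro!: derivative_eq_intros)
  from has_derivative_compose_within[OF this S'] assms
  have "((\<lambda>s. S s \<theta>) has_derivative (\<lambda>h. S' (h, 0))) (at \<tau> within {0..T})"
    by auto
  moreover have "(\<lambda>h. S' (h, 0)) = (\<lambda>h. h *\<^sub>R S' (1, 0))"
  proof
    fix h
    show "S' (h, 0) = h *\<^sub>R S' (1, 0)"
      using linear_cmul[OF has_derivative_linear[OF S'], of h "(1, 0)"] by simp
  qed
  ultimately have "((\<lambda>s. S s \<theta>) has_vector_derivative S' (1, 0)) (at \<tau> within {0..T})"
    unfolding has_vector_derivative_def by argo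
  with assms show ?thesis
    unfolding partial_tau_def by (intro vector_derivative_within_closed_interval)
qed

lemma partial_param_eq_frechet:
  fixes S :: "real \<Rightarrow> real^'p \<Rightarrow> real^'n^'n"
  assumes S': "((\<lambda>(\<tau>, \<theta>). S \<tau> \<theta>) has_derivative S') (at (\<tau>, \<theta>) within {0..T} \<times> cbox lo hi)"
    and "\<tau> \<in> {0..T}" "\<theta> \<in> cbox lo hi" "lo $ i < hi $ i"
  shows "partial_param lo hi S i \<tau> \<theta> = S' (0, axis i 1)"
proof -
  define line where "line r = (\<tau>, \<theta> + (r - \<theta> $ i) *\<^sub>R axis i 1)" for r
  have line_eq: "line r = (\<tau>, \<chi> j. if j = i then r else \<theta> $ j)" for r
    by (auto simp: line_def vec_eq_iff axis_def)
  have "(line has_derivative (\<lambda>h. (0, h *\<^sub>R axis i 1))) (at (\<theta> $ i) within {lo $ i..hi $ i})"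
    unfolding line_def by (auto intro!: derivative_eq_intros)
  moreover have "line ` {lo $ i..hi $ i} \<subseteq> {0..T} \<times> cbox lo hi"
    using assms by (auto simp: line_eq mem_box_cart)
  moreover have "line (\<theta> $ i) = (\<tau>, \<theta>)"
    by (simp add: line_def)
  ultimately have "((\<lambda>r. case line r of (\<tau>, \<theta>) \<Rightarrow> S \<tau> \<theta>) has_derivative (\<lambda>h. S' (0, h *\<^sub>R axis i 1)))
      (at (\<theta> $ i) within {lo $ i..hi $ i})"
    by (intro has_derivative_compose_within[OF _ S'])
  moreover have "S' (0, h *\<^sub>R axis i 1) = h *\<^sub>R S' (0, axis i 1)" for h
    using linear_cmul[OF has_derivative_linear[OF S'], of h "(0, axis i 1)"] by simp
  ultimately have "((\<lambda>r. S \<tau> (\<chi> j. if j = i then r else \<theta> $ j)) has_vector_derivative S' (0, axis i 1))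
      (at (\<theta> $ i) within {lo $ i..hi $ i})"
    by (simp add: line_eq has_vector_derivative_def)
  with assms show ?thesis
    unfolding partial_param_def
    by (auto simp: mem_box_cart intro!: vector_derivative_within_closed_interval)
qed

text \<open>
  In a degenerate coordinate an admissible rate vanishes, in agreement with the convention that the partial derivative is 0.
\<close>

lemma derivative_along_trajectory:
  fixes S :: "real \<Rightarrow> real^'p \<Rightarrow> real^'n^'n"
  assumes S: "(\<lambda>(\<tau>, \<theta>). S \<tau> \<theta>) differentiable_on ({0..T} \<times> cbox lo hi)"
    and T: "T > 0"
    and t: "t \<in> {a<..<a + T}"
    and \<rho>: "\<And>s. s \<in> {a<..<a + T} \<Longrightarrow> \<rho> s \<in> cbox lo hi"
    and d: "(\<rho> has_vector_derivative d) (at t)" "d \<in> admissible_rates lo hi nlo nhi (\<rho> t)"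
  shows "((\<lambda>s. S (s - a) (\<rho> s)) has_vector_derivative
           partial_tau T S (t - a) (\<rho> t) + param_derivative lo hi S (t - a) (\<rho> t) d) (at t)"
proof -
  let ?\<tau> = "t - a" and ?\<theta> = "\<rho> t"
  have mem: "?\<tau> \<in> {0..T}" "?\<theta> \<in> cbox lo hi" using t \<rho> by auto
  then obtain S' where S':
    "((\<lambda>(\<tau>, \<theta>). S \<tau> \<theta>) has_derivative S') (at (?\<tau>, ?\<theta>) within {0..T} \<times> cbox lo hi)"
    using S unfolding differentiable_on_def differentiable_def by blast
  note lin = has_derivative_linear[OF S']
  have "((\<lambda>s. (s - a, \<rho> s)) has_derivative (\<lambda>h. (h, h *\<^sub>R d))) (at t within {a<..<a + T})"
    using has_vector_derivative_at_within[OF d(1)]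
    by (auto intro!: derivative_eq_intros simp: has_vector_derivative_def)
  moreover have "(\<lambda>s. (s - a, \<rho> s)) ` {a<..<a + T} \<subseteq> {0..T} \<times> cbox lo hi"
    using \<rho> by auto
  ultimately have "((\<lambda>s. S (s - a) (\<rho> s)) has_derivative (\<lambda>h. S' (h, h *\<^sub>R d)))
      (at t within {a<..<a + T})"
    using has_derivative_compose_within[where f = "\<lambda>s. (s - a, \<rho> s)" and f' = "\<lambda>h. (h, h *\<^sub>R d)"
        and x = t and s = "{a<..<a + T}", OF _ S'] by simp
  moreover have "S' (h, h *\<^sub>R d) = h *\<^sub>R S' (1, d)" for h
    using linear_cmul[OF lin, of h "(1, d)"] by simp
  ultimately have *: "((\<lambda>s. S (s - a) (\<rho> s)) has_vector_derivative S' (1, d)) (at t)"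
    using t by (simp add: has_vector_derivative_def at_within_open[OF t])
  have coord: "S' (0, d $ i *\<^sub>R axis i 1) = d $ i *\<^sub>R partial_param lo hi S i ?\<tau> ?\<theta>" for i
  proof (cases "lo $ i < hi $ i")
    case True
    then show ?thesis
      using linear_cmul[OF lin, of "d $ i" "(0, axis i 1)"]
        partial_param_eq_frechet[OF S' mem True] by simp
  next
    case False
    with mem(2) have "lo $ i = ?\<theta> $ i" "hi $ i = ?\<theta> $ i"
      by (auto simp: mem_box_cart) (meson dual_order.trans linorder_not_le order_antisym)+
    with d(2) have "d $ i \<ge> 0" "d $ i \<le> 0"
      unfolding admissible_rates_def mem_Collect_eq by metis+
    then show ?thesis using linear_0[OF lin] by (simp add: zero_prod_def)
  qed
  \<comment> \<open>Linearity splits the derivative in the direction of the curve along the coordinate axes.\<close>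
  have "(1, d) = (1, 0) + (\<Sum>i\<in>UNIV. (0::real, d $ i *\<^sub>R axis i 1))"
    using basis_expansion[of d]
    by (simp add: prod_eq_iff fst_sum snd_sum scalar_mult_eq_scaleR)
  then have "S' (1, d) = S' (1, 0) + (\<Sum>i\<in>UNIV. S' (0, d $ i *\<^sub>R axis i 1))"
    by (simp only: linear_add[OF lin] linear_sum[OF lin])
  with * show ?thesis
    using partial_tau_eq_frechet[OF S' T mem]
    by (simp add: coord param_derivative_def)
qed

section \<open>Uniformity from compactness\<close>

lemma continuous_on_quad [continuous_intros]:
  "continuous_on K M \<Longrightarrow> continuous_on K f \<Longrightarrow> continuous_on K (\<lambda>p. quad (M p) (f p))"
  by (intro continuous_on_inner bounded_bilinear.continuous_on[OF bounded_bilinear_matrix_vector_mult])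

text \<open>
  On the product of \<open>K\<close> with the unit sphere the quadratic form attains its extrema, both positive;
  homogeneity of degree two carries the bounds to all vectors.
\<close>

lemma pos_def_uniform_bounds:
  fixes M :: "'a::metric_space \<Rightarrow> real^'n^'n"
  assumes "compact K" "K \<noteq> {}" "continuous_on K M" "\<And>p. p \<in> K \<Longrightarrow> pos_def (M p)"
  obtains c1 c2 where "c1 > 0" "c2 > 0"
    "\<And>p v. p \<in> K \<Longrightarrow> c1 * (norm v)\<^sup>2 \<le> quad (M p) v"
    "\<And>p v. p \<in> K \<Longrightarrow> quad (M p) v \<le> c2 * (norm v)\<^sup>2"
proof -
  let ?U = "K \<times> sphere (0::real^'n) 1"
  let ?q = "\<lambda>(p, v). quad (M p) v"
  have ne: "compact ?U" "?U \<noteq> {}" using assms by (auto intro: compact_Times)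
  have cont: "continuous_on ?U ?q"
    unfolding split_beta
    by (intro continuous_intros continuous_on_compose2[OF assms(3)]) auto
  from continuous_attains_inf[OF ne cont] obtain p1 v1
    where 1: "(p1, v1) \<in> ?U" "\<And>p v. (p, v) \<in> ?U \<Longrightarrow> quad (M p1) v1 \<le> quad (M p) v"
    by fastforce
  from continuous_attains_sup[OF ne cont] obtain p2 v2
    where 2: "(p2, v2) \<in> ?U" "\<And>p v. (p, v) \<in> ?U \<Longrightarrow> quad (M p) v \<le> quad (M p2) v2"
    by fastforce
  have "v = norm v *\<^sub>R sgn v" for v :: "real^'n"
    by (cases "v = 0") (simp_all add: sgn_div_norm)
  then have scale: "quad (M p) v = (norm v)\<^sup>2 * quad (M p) (sgn v)" for p v
    by (metis quad_scaleR_vector)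
  have sgn: "(p, sgn v) \<in> ?U" if "p \<in> K" "v \<noteq> 0" for p v
    using that by (simp add: norm_sgn)
  show ?thesis
  proof
    show "quad (M p1) v1 > 0" "quad (M p2) v2 > 0"
      using assms(4)[of p1] assms(4)[of p2] 1(1) 2(1)
      by (metis mem_Sigma_iff norm_zero pos_def_def dist_0_norm mem_sphere zero_neq_one)+
    fix p v assume "p \<in> K"
    show "quad (M p1) v1 * (norm v)\<^sup>2 \<le> quad (M p) v"
      using 1(2)[OF sgn[OF \<open>p \<in> K\<close>]] scale[of v p]
      by (cases "v = 0") (auto simp: mult.commute intro!: mult_left_mono)
    show "quad (M p) v \<le> quad (M p2) v2 * (norm v)\<^sup>2"
      using 2(2)[OF sgn[OF \<open>p \<in> K\<close>]] scale[of v p]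
      by (cases "v = 0") (auto simp: mult.commute intro!: mult_left_mono)
  qed
qed

text \<open>
  The bound \<open>Q\<close> has to hold for the form \<open>S 0 \<theta>\<close> for every \<open>\<theta>\<close>, so the parameter \<open>\<rho>\<close> may behave arbitrarily
  near \<open>a\<close>: only the clock and the state have to converge, because the form is uniformly continuous
  jointly in clock, parameter and state.
\<close>

lemma eventually_quad_le_after_switch:
  fixes S :: "real \<Rightarrow> 'a::metric_space \<Rightarrow> real^'n^'n"
  assumes K: "compact K" and S: "continuous_on ({0..T} \<times> K) (\<lambda>(\<tau>, \<theta>). S \<tau> \<theta>)" and T: "T > 0"
    and \<rho>: "\<And>s. s > a \<Longrightarrow> \<rho> s \<in> K"
    and x: "(x \<longlongrightarrow> x a) (at_right a)"
    and Q: "\<And>\<theta>. \<theta> \<in> K \<Longrightarrow> quad (S 0 \<theta>) (x a) \<le> Q"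
    and \<delta>: "\<delta> > 0"
  shows "\<forall>\<^sub>F s in at_right a. quad (S (s - a) (\<rho> s)) (x s) \<le> Q + \<delta>"
proof -
  let ?D = "({0..T} \<times> K) \<times> cball (x a) 1"
  let ?q = "\<lambda>((\<tau>, \<theta>), v). quad (S \<tau> \<theta>) v"
  have "continuous_on ?D ?q"
    unfolding split_beta
    by (intro continuous_intros continuous_on_compose2[OF S[unfolded split_beta]]) auto
  moreover have "compact ?D" using K by (intro compact_Times) auto
  ultimately have "uniformly_continuous_on ?D ?q"
    by (rule compact_uniformly_continuous)
  then obtain e where e: "e > 0"
    "\<And>p p'. p \<in> ?D \<Longrightarrow> p' \<in> ?D \<Longrightarrow> dist p' p < e \<Longrightarrow> dist (?q p') (?q p) < \<delta>"
    using uniformly_continuous_onE[OF _ \<delta>] by blast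
  have "((\<lambda>s. dist ((s - a, \<theta>), x s) ((0, \<theta>), x a)) \<longlongrightarrow> dist ((a - a, \<theta>), x a) ((0, \<theta>), x a)) (at_right a)" for \<theta> :: 'a
    by (intro tendsto_intros x)
  then have close: "\<forall>\<^sub>F s in at_right a. dist ((s - a, \<theta>), x s) ((0, \<theta>), x a) < e" for \<theta> :: 'a
    using e(1) by (auto dest: order_tendstoD)
  \<comment> \<open>The two points share the parameter, so their distance does not depend on it. This makes the
    closeness uniform in the parameter, and any fixed value can stand for it.\<close>
  have dist_eq: "dist ((s - a, \<theta>), x s) ((0, \<theta>), x a) = dist ((s - a, \<theta>'), x s) ((0, \<theta>'), x a)"
    for s and \<theta> \<theta>' :: 'a
    by (simp add: dist_Pair_Pair)
  have "\<forall>\<^sub>F s in at_right a. dist (x s) (x a) < 1"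
    using tendstoD[OF x] by simp
  moreover have "\<forall>\<^sub>F s in at_right a. s < a + T" "\<forall>\<^sub>F s in at_right a. s > a"
    using T by (auto simp: eventually_at_right_less intro!: order_tendstoD(2)[OF tendsto_ident_at])
  ultimately show ?thesis using close[of undefined]
  proof eventually_elim
    case (elim s)
    have "dist (?q ((s - a, \<rho> s), x s)) (?q ((0, \<rho> s), x a)) < \<delta>"
      using elim \<rho> T dist_eq[of s undefined "\<rho> s"] by (intro e(2)) (auto simp: dist_commute)
    moreover have "quad (S 0 (\<rho> s)) (x a) \<le> Q" using Q \<rho> elim by blast
    ultimately show ?case by (auto simp: dist_real_def)
  qed
qed

section \<open>Decay of the clock-dependent Lyapunov function\<close>

text \<open>
  Definiteness of the certificate enters through the constants \<open>c1\<close> and \<open>c2\<close>, which are fixed here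
  because the decay estimate is expressed in them.
\<close>

locale clock_dependent_lyapunov =
  fixes lo hi nlo nhi :: "real^'p"
    and A :: "real^'p \<Rightarrow> real^'n^'n"
    and T \<epsilon> c1 c2 :: real
    and S :: "real \<Rightarrow> real^'p \<Rightarrow> real^'n^'n"
  assumes T_pos: "T > 0" and \<epsilon>_pos: "\<epsilon> > 0" and c1_pos: "c1 > 0" and c2_pos: "c2 > 0"
    and differentiable: "(\<lambda>(\<tau>, \<theta>). S \<tau> \<theta>) differentiable_on ({0..T} \<times> cbox lo hi)"
    and symmetric: "\<And>\<tau> \<theta>. \<tau> \<in> {0..T} \<Longrightarrow> \<theta> \<in> cbox lo hi \<Longrightarrow> transpose (S \<tau> \<theta>) = S \<tau> \<theta>"
    and lower: "\<And>\<tau> \<theta> v. \<tau> \<in> {0..T} \<Longrightarrow> \<theta> \<in> cbox lo hi \<Longrightarrow> c1 * (norm v)\<^sup>2 \<le> quad (S \<tau> \<theta>) v"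
    and upper: "\<And>\<tau> \<theta> v. \<tau> \<in> {0..T} \<Longrightarrow> \<theta> \<in> cbox lo hi \<Longrightarrow> quad (S \<tau> \<theta>) v \<le> c2 * (norm v)\<^sup>2"
    and flow: "\<And>\<tau> \<theta> \<mu>. \<tau> \<in> {0..T} \<Longrightarrow> \<theta> \<in> cbox lo hi \<Longrightarrow> \<mu> \<in> box_vertices nlo nhi \<Longrightarrow>
           partial_tau T S \<tau> \<theta> + param_derivative lo hi S \<tau> \<theta> \<mu>
             + Sym (S \<tau> \<theta> ** A \<theta>) + \<epsilon> *\<^sub>R mat 1 \<preceq>\<^sub>L 0"
    and switch: "\<And>\<theta> \<eta>. \<theta> \<in> cbox lo hi \<Longrightarrow> \<eta> \<in> cbox lo hi \<Longrightarrow> S 0 \<theta> - S T \<eta> \<preceq>\<^sub>L 0"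
begin

definition decay_rate :: real where
  "decay_rate = \<epsilon> / c2"

text \<open>
  Here \<open>a\<close> is the switching time that starts the current interval, so that \<open>t - a\<close> is the clock. With the
  weight counted from \<open>a\<close>, decay at rate \<open>decay_rate\<close> becomes monotonicity.
\<close>

definition weighted_energy :: "real \<Rightarrow> (real \<Rightarrow> real^'p) \<Rightarrow> (real \<Rightarrow> real^'n) \<Rightarrow> real \<Rightarrow> real" where
  "weighted_energy a \<rho> x t = exp (decay_rate * (t - a)) * quad (S (t - a) (\<rho> t)) (x t)"

lemma decay_rate_pos: "decay_rate > 0"
  using \<epsilon>_pos c2_pos by (simp add: decay_rate_def)

text \<open>
  Evaluated at a fixed vector, the matrix inequality is a scalar inequality affine in the rate, so it
  extends from the vertices to the rate box.
\<close>

lemma dissipation: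
  assumes "\<tau> \<in> {0..T}" "\<theta> \<in> cbox lo hi" "d \<in> cbox nlo nhi"
  shows "quad (partial_tau T S \<tau> \<theta> + param_derivative lo hi S \<tau> \<theta> d + Sym (S \<tau> \<theta> ** A \<theta>)) v
           \<le> - \<epsilon> * (norm v)\<^sup>2"
proof -
  let ?a = "quad (partial_tau T S \<tau> \<theta>) v + quad (Sym (S \<tau> \<theta> ** A \<theta>)) v"
  let ?b = "\<lambda>i. quad (partial_param lo hi S i \<tau> \<theta>) v"
  have "?a + (\<Sum>i\<in>UNIV. d $ i * ?b i) \<le> - \<epsilon> * (norm v)\<^sup>2"
  proof (rule affine_le_if_vertices_le[OF _ assms(3)])
    fix \<mu> assume "\<mu> \<in> box_vertices nlo nhi"
    from loewner_le_quad[OF flow[OF assms(1,2) this], of v]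
    show "?a + (\<Sum>i\<in>UNIV. \<mu> $ i * ?b i) \<le> - \<epsilon> * (norm v)\<^sup>2"
      by (simp add: param_derivative_def matrix_vector_mult_add_rdistrib inner_add_right
          quad_sum quad_scaleR power2_norm_eq_inner)
  qed
  then show ?thesis
    by (simp add: param_derivative_def matrix_vector_mult_add_rdistrib inner_add_right
        quad_sum quad_scaleR)
qed

text \<open>
  The left end point \<open>a\<close> is excluded because the parameter may jump there; left continuity of the
  parameter gives the right end point, where it need not be differentiable.
\<close>

lemma weighted_energy_antimono:
  assumes \<rho>: "\<And>t. t \<in> {a<..a + T} \<Longrightarrow> \<rho> t \<in> cbox lo hi"
    and \<rho>_left: "continuous (at_left (a + T)) \<rho>"
    and \<rho>_deriv: "\<And>t. t \<in> {a<..<a + T} \<Longrightarrow>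
      \<exists>d\<in>admissible_rates lo hi nlo nhi (\<rho> t). (\<rho> has_vector_derivative d) (at t)"
    and x: "continuous_on {a..a + T} x"
    and x_deriv: "\<And>t. t \<in> {a<..<a + T} \<Longrightarrow> (x has_vector_derivative A (\<rho> t) *v x t) (at t)"
    and st: "a < s" "s < t" "t \<le> a + T"
  shows "weighted_energy a \<rho> x t \<le> weighted_energy a \<rho> x s"
proof (rule DERIV_nonpos_imp_decreasing_open[OF less_imp_le[OF st(2)]])
  fix u assume "s < u" "u < t"
  then have u: "u \<in> {a<..<a + T}" and mem: "u - a \<in> {0..T}" "\<rho> u \<in> cbox lo hi"
    using st \<rho> by auto
  from \<rho>_deriv[OF u] obtain d where d: "d \<in> admissible_rates lo hi nlo nhi (\<rho> u)"
    "(\<rho> has_vector_derivative d) (at u)" by blast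
  let ?q = "\<lambda>u. quad (S (u - a) (\<rho> u)) (x u)"
  let ?q' = "quad (partial_tau T S (u - a) (\<rho> u) + param_derivative lo hi S (u - a) (\<rho> u) d
                + Sym (S (u - a) (\<rho> u) ** A (\<rho> u))) (x u)"
  let ?e = "\<lambda>u. exp (decay_rate * (u - a))"
  have q: "(?q has_real_derivative ?q') (at u)"
    using \<rho> by (intro quad_has_real_derivative x_deriv[OF u] symmetric mem
        derivative_along_trajectory[OF differentiable T_pos u _ d(2,1)]) auto
  have "(weighted_energy a \<rho> x has_real_derivative ?e u * (decay_rate * ?q u + ?q')) (at u)"
    unfolding weighted_energy_def
    by (rule derivative_eq_intros q refl | simp add: algebra_simps)+
  moreover have "decay_rate * ?q u + ?q' \<le> 0"
  proof -
    have "?q' \<le> - \<epsilon> * (norm (x u))\<^sup>2"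
      using d(1) by (intro dissipation mem) (simp add: admissible_rates_def)
    moreover have "decay_rate * ?q u \<le> decay_rate * (c2 * (norm (x u))\<^sup>2)"
      using decay_rate_pos upper[OF mem] by (intro mult_left_mono) auto
    ultimately show ?thesis using c2_pos by (simp add: decay_rate_def)
  qed
  ultimately show "\<exists>y. (weighted_energy a \<rho> x has_real_derivative y) (at u) \<and> y \<le> 0"
    by (meson exp_ge_zero mult_nonneg_nonpos)
next
  have \<rho>_cont: "continuous_on {s..t} \<rho>"
    unfolding continuous_on_eq_continuous_within
  proof
    fix u assume u: "u \<in> {s..t}"
    show "continuous (at u within {s..t}) \<rho>"
    proof (cases "u = a + T")
      case True
      then have "u = t" using u st by auto
      with \<rho>_left True st show ?thesis by (simp add: at_within_Icc_at_left)
    next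
      case False
      with u st \<rho>_deriv[of u] have "continuous (at u) \<rho>"
        using has_vector_derivative_continuous by fastforce
      then show ?thesis by (rule continuous_at_imp_continuous_at_within)
    qed
  qed
  have "continuous_on {s..t} (\<lambda>u. case (u - a, \<rho> u) of (\<tau>, \<theta>) \<Rightarrow> S \<tau> \<theta>)"
    using \<rho> st
    by (intro continuous_on_compose2[OF differentiable_imp_continuous_on[OF differentiable]]
        continuous_intros \<rho>_cont) auto
  then show "continuous_on {s..t} (weighted_energy a \<rho> x)"
    unfolding weighted_energy_def using st
    by (intro continuous_intros continuous_on_subset[OF x]) auto
qed

text \<open>
  Let the starting point \<open>s\<close> of the monotonicity estimate decrease to \<open>a\<close>. The bound is in terms of the
  form at the end of the clock cycle, for an arbitrary parameter \<open>\<eta>\<close>; with the parameter value at \<open>a\<close>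
  it links the interval to the preceding one.
\<close>

lemma weighted_energy_le_at_switch:
  assumes \<rho>: "\<And>t. t > a \<Longrightarrow> \<rho> t \<in> cbox lo hi"
    and \<rho>_left: "continuous (at_left (a + T)) \<rho>"
    and \<rho>_deriv: "\<And>t. t \<in> {a<..<a + T} \<Longrightarrow>
      \<exists>d\<in>admissible_rates lo hi nlo nhi (\<rho> t). (\<rho> has_vector_derivative d) (at t)"
    and x: "continuous_on {a..a + T} x"
    and x_deriv: "\<And>t. t \<in> {a<..<a + T} \<Longrightarrow> (x has_vector_derivative A (\<rho> t) *v x t) (at t)"
    and t: "a < t" "t \<le> a + T"
    and \<eta>: "\<eta> \<in> cbox lo hi"
  shows "weighted_energy a \<rho> x t \<le> quad (S T \<eta>) (x a)"
proof (rule field_le_epsilon)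
  fix \<delta> :: real assume \<delta>: "\<delta> > 0"
  let ?Q = "quad (S T \<eta>) (x a)"
  have Q: "quad (S 0 \<theta>) (x a) \<le> ?Q" if "\<theta> \<in> cbox lo hi" for \<theta>
    using loewner_le_quad[OF switch[OF that \<eta>], of "x a"]
    by (simp add: matrix_vector_mult_diff_rdistrib inner_diff_right)
  have x_lim: "(x \<longlongrightarrow> x a) (at_right a)"
    using x T_pos by (metis atLeastAtMost_iff at_within_Icc_at_right continuous_on_def less_add_same_cancel1
        less_eq_real_def)
  have "\<forall>\<^sub>F s in at_right a. quad (S (s - a) (\<rho> s)) (x s) \<le> ?Q + \<delta>"
    by (rule eventually_quad_le_after_switch[OF compact_cbox
          differentiable_imp_continuous_on[OF differentiable] T_pos \<rho> x_lim Q \<delta>])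
  moreover have "\<forall>\<^sub>F s in at_right a. a < s" "\<forall>\<^sub>F s in at_right a. s < t"
    using t by (auto simp: eventually_at_right_less intro!: order_tendstoD(2)[OF tendsto_ident_at])
  ultimately have "\<forall>\<^sub>F s in at_right a. weighted_energy a \<rho> x t \<le> exp (decay_rate * (s - a)) * (?Q + \<delta>)"
  proof eventually_elim
    case (elim s)
    have "weighted_energy a \<rho> x t \<le> weighted_energy a \<rho> x s"
      using elim t \<rho> by (intro weighted_energy_antimono \<rho>_left \<rho>_deriv x x_deriv) auto
    also have "\<dots> \<le> exp (decay_rate * (s - a)) * (?Q + \<delta>)"
      unfolding weighted_energy_def using elim by (intro mult_left_mono) auto
    finally show ?case .
  qed
  moreover have "((\<lambda>s. exp (decay_rate * (s - a)) * (?Q + \<delta>)) \<longlongrightarrow>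
      exp (decay_rate * (a - a)) * (?Q + \<delta>)) (at_right a)"
    by (intro tendsto_intros)
  ultimately show "weighted_energy a \<rho> x t \<le> ?Q + \<delta>"
    using tendsto_lowerbound[of _ "exp (decay_rate * (a - a)) * (?Q + \<delta>)" "at_right a"] by simp
qed

text \<open>
  Each interval passes on the quantity \<open>exp (decay_rate * a) * quad (S T (\<rho> a)) (x a)\<close> taken at its
  starting time \<open>a\<close>. At time 0 this uses the clock value \<open>T\<close> rather than 0, which lets the initial
  interval be treated like all the others.
\<close>

lemma exponential_decay:
  assumes \<rho>: "\<rho> \<in> param_trajectories T lo hi nlo nhi"
    and x: "lpv_solution (switching_times T) A \<rho> x0 x"
    and t: "t \<ge> 0"
  shows "c1 * (norm (x t))\<^sup>2 \<le> exp (- decay_rate * t) * (c2 * (norm x0)\<^sup>2)"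
proof -
  have \<rho>_mem: "\<rho> s \<in> cbox lo hi" if "s \<ge> 0" for s
    using \<rho> that by (simp add: param_trajectories_def)
  have x_cont: "continuous_on {0..} x" and x_0: "x 0 = x0"
    using x by (auto simp: lpv_solution_def)
  have interval: "exp (decay_rate * s) * quad (S (s - real k * T) (\<rho> s)) (x s)
      \<le> exp (decay_rate * (real k * T)) * quad (S T \<eta>) (x (real k * T))"
    if s: "real k * T < s" "s \<le> real k * T + T" and \<eta>: "\<eta> \<in> cbox lo hi" for k s \<eta>
  proof -
    let ?a = "real k * T"
    have a: "?a \<ge> 0" using T_pos by simp
    have "weighted_energy ?a \<rho> x s \<le> quad (S T \<eta>) (x ?a)"
    proof (rule weighted_energy_le_at_switch[OF _ _ _ _ _ s \<eta>])
      show "\<rho> u \<in> cbox lo hi" if "u > ?a" for u using that a \<rho>_mem by simp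
      show "continuous (at_left (?a + T)) \<rho>"
        using \<rho> add_nonneg_pos[OF a T_pos] by (simp add: param_trajectories_def)
      show "continuous_on {?a..?a + T} x"
        using a by (intro continuous_on_subset[OF x_cont]) auto
      fix u assume u: "u \<in> {?a<..<?a + T}"
      then have u': "u \<in> {real k * T<..<real (Suc k) * T}" by (simp add: algebra_simps)
      then show "\<exists>d\<in>admissible_rates lo hi nlo nhi (\<rho> u). (\<rho> has_vector_derivative d) (at u)"
        using \<rho> by (simp only: param_trajectories_def mem_Collect_eq)
      have "u \<notin> switching_times T"
      proof
        assume "u \<in> switching_times T"
        then obtain j :: nat where "u = real j * T" by (auto simp: switching_times_def)
        with u' T_pos have "k < j \<and> j < Suc k" by (auto simp del: of_nat_Suc)
        then show False by linarith
      qed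
      moreover have "u > 0" using u le_less_trans[OF a, of u] by auto
      ultimately have "(x has_vector_derivative A (\<rho> u) *v x u) (at u within {0..})"
        using x by (simp add: lpv_solution_def)
      moreover have "at u within {0..} = at u"
        using \<open>u > 0\<close> by (intro at_within_interior) simp
      ultimately show "(x has_vector_derivative A (\<rho> u) *v x u) (at u)" by simp
    qed
    from mult_left_mono[OF this exp_ge_zero[of "decay_rate * ?a"]] show ?thesis
      by (simp add: weighted_energy_def right_diff_distrib exp_diff)
  qed
  have switches: "exp (decay_rate * (real k * T)) * quad (S T (\<rho> (real k * T))) (x (real k * T))
      \<le> c2 * (norm x0)\<^sup>2" for k
  proof (induction k)
    case 0
    show ?case using upper[of T "\<rho> 0"] T_pos \<rho>_mem x_0 by simp
  next
    case (Suc k)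
    have "real (Suc k) * T = real k * T + T" by (simp add: algebra_simps)
    with interval[of k "real (Suc k) * T" "\<rho> (real k * T)"] T_pos \<rho>_mem Suc.IH
    show ?case by simp
  qed
  have "exp (decay_rate * t) * (c1 * (norm (x t))\<^sup>2) \<le> c2 * (norm x0)\<^sup>2"
  proof (cases "t = 0")
    case True
    then show ?thesis using lower[of 0 "\<rho> 0" x0] upper[of 0 "\<rho> 0" x0] T_pos \<rho>_mem x_0 by simp
  next
    case False
    \<comment> \<open>The intervals are open on the left and closed on the right, hence the ceiling minus one.\<close>
    define k where "k = nat (\<lceil>t / T\<rceil> - 1)"
    have "t / T > 0" using False t T_pos by simp
    then have "real k = \<lceil>t / T\<rceil> - 1" unfolding k_def by (subst of_nat_nat) linarith+
    then have "real k < t / T" "t / T \<le> real k + 1" by linarith+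
    then have s: "real k * T < t" "t \<le> real k * T + T"
      using T_pos by (simp_all add: field_simps)
    have "exp (decay_rate * t) * (c1 * (norm (x t))\<^sup>2)
        \<le> exp (decay_rate * t) * quad (S (t - real k * T) (\<rho> t)) (x t)"
      using s t \<rho>_mem by (intro mult_left_mono lower) auto
    also have "\<dots> \<le> exp (decay_rate * (real k * T)) * quad (S T (\<rho> (real k * T))) (x (real k * T))"
      using T_pos by (intro interval s \<rho>_mem) simp
    also note switches
    finally show ?thesis .
  qed
  from mult_left_mono[OF this exp_ge_zero[of "- decay_rate * t"]] show ?thesis
    by (simp flip: mult.assoc exp_add)
qed

end

section \<open>Asymptotic stability\<close>

lemma asymptotically_stable_if_exponential_decay:
  assumes "c > 0" "K > 0"
    and decay: "\<And>\<rho> x0 x t. \<rho> \<in> F \<Longrightarrow> lpv_solution J A \<rho> x0 x \<Longrightarrow> t \<ge> 0 \<Longrightarrow>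
      norm (x t) \<le> K * exp (- c * t) * norm x0"
  shows "lpv_asymptotically_stable J A F"
  unfolding lpv_asymptotically_stable_def
proof (intro conjI allI impI exI[of _ "\<lambda>r. K * r"])
  show "class_K_infinity (\<lambda>r. K * r)"
    using \<open>K > 0\<close> unfolding class_K_infinity_def
    by (auto intro!: continuous_intros strict_mono_onI
        filterlim_tendsto_pos_mult_at_top[OF tendsto_const] filterlim_ident)
  show "\<forall>\<rho>\<in>F. \<forall>x0 x. lpv_solution J A \<rho> x0 x \<longrightarrow> (\<forall>t\<ge>0. norm (x t) \<le> K * norm x0)"
  proof (intro ballI allI impI)
    fix \<rho> x0 x t assume *: "\<rho> \<in> F" "lpv_solution J A \<rho> x0 x" "(t::real) \<ge> 0"
    have "K * exp (- c * t) * norm x0 \<le> K * 1 * norm x0"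
      using * \<open>c > 0\<close> \<open>K > 0\<close> by (intro mult_right_mono mult_left_mono) auto
    with decay[OF *] show "norm (x t) \<le> K * norm x0" by simp
  qed
next
  fix r e :: real assume "r > 0" "e > 0"
  have "((\<lambda>t. K * exp (- c * t) * r) \<longlongrightarrow> 0) at_top"
    using \<open>c > 0\<close>
    by (intro tendsto_mult_left_zero tendsto_mult_right_zero filterlim_compose[OF exp_at_bot]
        filterlim_tendsto_neg_mult_at_bot[OF tendsto_const _ filterlim_ident]) simp
  then have "\<forall>\<^sub>F t in at_top. K * exp (- c * t) * r < e"
    using \<open>e > 0\<close> by (rule order_tendstoD)
  then obtain t0 where t0: "\<And>t. t \<ge> t0 \<Longrightarrow> K * exp (- c * t) * r < e"
    by (auto simp: eventually_at_top_linorder)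
  show "\<exists>t'\<ge>0. \<forall>\<rho>\<in>F. \<forall>x0 x. norm x0 \<le> r \<longrightarrow> lpv_solution J A \<rho> x0 x \<longrightarrow> (\<forall>t\<ge>t'. norm (x t) \<le> e)"
  proof (intro exI[of _ "max 0 t0"] conjI ballI allI impI)
    fix \<rho> x0 x t assume *: "\<rho> \<in> F" "norm x0 \<le> r" "lpv_solution J A \<rho> x0 x" "t \<ge> max 0 t0"
    have "norm (x t) \<le> K * exp (- c * t) * norm x0" using decay * by simp
    also have "\<dots> \<le> K * exp (- c * t) * r" using * \<open>K > 0\<close> by (intro mult_left_mono) auto
    also have "\<dots> \<le> e" using t0[of t] * by simp
    finally show "norm (x t) \<le> e" .
  qed simp
qed

theorem theorem2:
  fixes lo hi nlo nhi :: "real^'p"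
    and A :: "real^'p \<Rightarrow> real^'n^'n"
    and T \<epsilon> :: real
    and S :: "real \<Rightarrow> real^'p \<Rightarrow> real^'n^'n"
  assumes "\<forall>i. lo $ i \<le> hi $ i"
    and "\<forall>i. nlo $ i \<le> nhi $ i"
    and "bounded (A ` cbox lo hi)"
    and "continuous_on (cbox lo hi) A"
    and "T > 0"
    and "\<forall>\<tau>\<in>{0..T}. \<forall>\<theta>\<in>cbox lo hi. pos_def (S \<tau> \<theta>)"
    and "bounded ((\<lambda>(\<tau>, \<theta>). S \<tau> \<theta>) ` ({0..T} \<times> cbox lo hi))"
    and "continuously_differentiable T lo hi S"
    and "\<epsilon> > 0"
    and "\<forall>\<theta>\<in>cbox lo hi. \<forall>\<mu>\<in>box_vertices nlo nhi. \<forall>\<tau>\<in>{0..T}.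
           partial_tau T S \<tau> \<theta> + param_derivative lo hi S \<tau> \<theta> \<mu>
             + Sym (S \<tau> \<theta> ** A \<theta>) + \<epsilon> *\<^sub>R mat 1 \<preceq>\<^sub>L 0"
    and "\<forall>\<theta>\<in>cbox lo hi. \<forall>\<eta>\<in>cbox lo hi. S 0 \<theta> - S T \<eta> \<preceq>\<^sub>L 0"
  shows "lpv_asymptotically_stable (switching_times T) A (param_trajectories T lo hi nlo nhi)"
proof -
  have diff: "(\<lambda>(\<tau>, \<theta>). S \<tau> \<theta>) differentiable_on ({0..T} \<times> cbox lo hi)"
    using assms(8) by (simp add: continuously_differentiable_def)
  have "lo \<in> cbox lo hi" using assms(1) by (simp add: mem_box_cart)
  then have "{0..T} \<times> cbox lo hi \<noteq> {}" using \<open>T > 0\<close> by force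
  moreover have "compact ({0..T} \<times> cbox lo hi)"
    by (intro compact_Times compact_Icc compact_cbox)
  moreover have "pos_def (case p of (\<tau>, \<theta>) \<Rightarrow> S \<tau> \<theta>)" if "p \<in> {0..T} \<times> cbox lo hi" for p
    using that assms(6) by auto
  ultimately obtain c1 c2 where c: "c1 > 0" "c2 > 0"
    and bounds: "\<And>p v. p \<in> {0..T} \<times> cbox lo hi \<Longrightarrow> c1 * (norm v)\<^sup>2 \<le> quad (case p of (\<tau>, \<theta>) \<Rightarrow> S \<tau> \<theta>) v"
    "\<And>p v. p \<in> {0..T} \<times> cbox lo hi \<Longrightarrow> quad (case p of (\<tau>, \<theta>) \<Rightarrow> S \<tau> \<theta>) v \<le> c2 * (norm v)\<^sup>2"
    using pos_def_uniform_bounds[OF _ _ differentiable_imp_continuous_on[OF diff]] by blast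
  have "c1 * (norm v)\<^sup>2 \<le> quad (S \<tau> \<theta>) v" "quad (S \<tau> \<theta>) v \<le> c2 * (norm v)\<^sup>2"
    if "\<tau> \<in> {0..T}" "\<theta> \<in> cbox lo hi" for \<tau> \<theta> v
    using bounds[of "(\<tau>, \<theta>)" v] that by auto
  then interpret clock_dependent_lyapunov lo hi nlo nhi A T \<epsilon> c1 c2 S
    using assms(5,6,9,10,11) c diff by unfold_locales (simp_all add: pos_def_def)
  show ?thesis
  proof (rule asymptotically_stable_if_exponential_decay)
    show "decay_rate / 2 > 0" "sqrt (c2 / c1) > 0"
      using decay_rate_pos c by auto
    fix \<rho> x0 x t
    assume "\<rho> \<in> param_trajectories T lo hi nlo nhi"
      "lpv_solution (switching_times T) A \<rho> x0 x" "(t::real) \<ge> 0"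
    from exponential_decay[OF this]
    have "(norm (x t))\<^sup>2 \<le> c2 / c1 * exp (- decay_rate * t) * (norm x0)\<^sup>2"
      using c by (simp add: field_simps)
    also have "\<dots> = (sqrt (c2 / c1) * exp (- (decay_rate / 2) * t) * norm x0)\<^sup>2"
      using c exp_double[of "- (decay_rate / 2) * t"] by (simp add: power_mult_distrib)
    finally show "norm (x t) \<le> sqrt (c2 / c1) * exp (- (decay_rate / 2) * t) * norm x0"
      by (rule power2_le_imp_le) (use c in auto)
  qed
qed

end
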